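(* Let $n\geq 3$ be an integer and let $k_{1}$ and $k_{2}$ be integers such that $1\leq k_{1}<k_{2}\leq\frac{n}{2}$. The accordion graphs $A[n,k_{1}]$ and $A[n,k_{2}]$ are isomorphic if and only if both of the following hold: (i) $\gcd(n,k_{1})=\gcd(n,k_{2})=2$; and (ii) $\frac{k_{1}k_{2}}{2}\equiv\pm2\pmod{n}$.
   Context: For integers $n\geq 3$ and $1\leq k\leq \frac{n}{2}$, the accordion graph $A[n,k]$ is the 4-regular graph with vertex set $\{u_1,\ldots,u_n,v_1,\ldots,v_n\}$ such that $(u_1,u_2,\ldots,u_n)$ and $(v_1,v_2,\ldots,v_n)$ are $n$-cycles, $u_i$ is adjacent to $v_i$ for every $i\in\{1,\ldots,n\}$, and $u_i$ is adjacent to $v_{i+k}$ for every $i\in\{1,\ldots,n\}$, where indices are taken modulo $n$ with residue system $\{1,\ldots,n\}$. *)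

theory Defs
  imports "Graph_Theory.Graph_Theory" "HOL-Number_Theory.Cong"
begin

datatype accordion_vertex = U nat | V nat

text \<open>Reduction modulo \<open>n\<close> into the residue system \<open>{1..n}\<close> (so \<open>n\<close> itself represents \<open>0\<close>).\<close>

definition wrap :: "nat \<Rightarrow> nat \<Rightarrow> nat" where
  "wrap n i = (if i mod n = 0 then n else i mod n)"

definition accordion_verts :: "nat \<Rightarrow> accordion_vertex set" where
  "accordion_verts n = U ` {1..n} \<union> V ` {1..n}"

definition accordion_edges :: "nat \<Rightarrow> nat \<Rightarrow> accordion_vertex set set" where
  "accordion_edges n k =
     {{U i, U (wrap n (i + 1))} | i. i \<in> {1..n}} \<union>
     {{V i, V (wrap n (i + 1))} | i. i \<in> {1..n}} \<union>
     {{U i, V i} | i. i \<in> {1..n}} \<union>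
     {{U i, V (wrap n (i + k))} | i. i \<in> {1..n}}"

text \<open>
  An undirected simple graph is a loop-free symmetric digraph without parallel arcs: each edge
  \<open>{x, y}\<close> is represented by the two arcs \<open>(x, y)\<close> and \<open>(y, x)\<close>.
\<close>

definition accordion :: "nat \<Rightarrow> nat \<Rightarrow> accordion_vertex pair_pre_digraph" where
  "accordion n k =
     \<lparr>pverts = accordion_verts n, parcs = {(x, y). {x, y} \<in> accordion_edges n k}\<rparr>"

lemma wrap_in: "0 < n \<Longrightarrow> wrap n i \<in> {1..n}"
  by (auto simp: wrap_def Suc_le_eq intro: less_imp_le)

lemma wrap_id: "i \<in> {1..n} \<Longrightarrow> wrap n i = i"
  by (cases "i = n") (auto simp: wrap_def)

lemma wrap_Suc: "i \<in> {1..n} \<Longrightarrow> wrap n (Suc i) = (if i = n then 1 else i + 1)"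
  by (cases "n = 1") (auto simp: wrap_def mod_Suc)

lemma wrap_add:
  "i \<in> {1..n} \<Longrightarrow> k \<le> n \<Longrightarrow> wrap n (i + k) = (if i + k \<le> n then i + k else i + k - n)"
proof -
  assume "i \<in> {1..n}" "k \<le> n"
  moreover from this have "(i + k) mod n = (i + k - n) mod n" if "\<not> i + k < n"
    using that by (metis le_mod_geq not_less)
  moreover from calculation have "i + k - n < n \<or> i = n \<and> k = n" by auto
  ultimately show ?thesis
    by (cases "i + k < n"; cases "i + k = n") (auto simp: wrap_def)
qed

lemma accordion_arc_iff:
  "(x, y) \<in> parcs (accordion n k) \<longleftrightarrow>
    (\<exists>i\<in>{1..n}.
        {x, y} = {U i, U (wrap n (i + 1))} \<or> {x, y} = {V i, V (wrap n (i + 1))} \<or>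
        {x, y} = {U i, V i} \<or> {x, y} = {U i, V (wrap n (i + k))})"
  unfolding accordion_def accordion_edges_def pair_pre_digraph.simps mem_Collect_eq case_prod_conv
    Un_iff by blast

lemma pair_graph_accordion:
  assumes "3 \<le> n"
  shows "pair_graph (accordion n k)"
proof -
  have ne: "wrap n (i + 1) \<noteq> i" if "i \<in> {1..n}" for i
    using that assms by (auto simp: wrap_Suc)
  have ends: "x \<in> accordion_verts n \<and> y \<in> accordion_verts n \<and> x \<noteq> y"
    if "(x, y) \<in> parcs (accordion n k)" for x y
  proof -
    have "{x, y} \<in> accordion_edges n k"
      using that by (simp add: accordion_def)
    then show ?thesis
      using assms wrap_in[of n] ne ne[symmetric]
      unfolding accordion_edges_def accordion_verts_def
      by (auto simp: doubleton_eq_iff simp del: atLeastAtMost_iff One_nat_def)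
  qed
  have fin: "finite (accordion_verts n)"
    by (simp add: accordion_verts_def)
  have "parcs (accordion n k) \<subseteq> accordion_verts n \<times> accordion_verts n"
    using ends by auto
  then have "finite (parcs (accordion n k))"
    using fin by (meson finite_SigmaI finite_subset)
  then show ?thesis
    using fin
    by unfold_locales (auto simp: accordion_def insert_commute symmetric_def intro: symI
        dest: ends[unfolded accordion_def, simplified])
qed

lemma wrap_Suc_eq_iff:
  assumes "3 \<le> n" "i \<in> {1..n}" "j \<in> {1..n}"
  shows "wrap n (j + 1) = i \<longleftrightarrow> j = (if i = 1 then n else i - 1)"
proof -
  have "wrap n (j + 1) = (if j = n then 1 else j + 1)"
    using wrap_Suc assms(3) by simp
  then show ?thesis using assms by (cases "j = n"; cases "i = 1") auto
qed

lemma wrap_add_eq_iff: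
  assumes "1 \<le> k" "k \<le> n" "i \<in> {1..n}" "j \<in> {1..n}"
  shows "wrap n (j + k) = i \<longleftrightarrow> j = (if i \<le> k then i + n - k else i - k)"
  unfolding wrap_add[OF assms(4,2)]
  using assms by (cases "j + k \<le> n"; cases "i \<le> k") auto

lemma accordion_arc_U_iff:
  assumes "3 \<le> n" "i \<in> {1..n}"
  shows "(U i, y) \<in> parcs (accordion n k) \<longleftrightarrow>
    y \<in> {U (wrap n (i + 1)), U (if i = 1 then n else i - 1), V i, V (wrap n (i + k))}"
proof -
  let ?p = "if i = 1 then n else i - 1"
  have p: "?p \<in> {1..n}" using assms by auto
  have "(U i, y) \<in> parcs (accordion n k) \<longleftrightarrow>
      y = U (wrap n (i + 1)) \<or> (\<exists>j\<in>{1..n}. y = U j \<and> wrap n (j + 1) = i) \<or>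
      y = V i \<or> y = V (wrap n (i + k))"
    unfolding accordion_arc_iff doubleton_eq_iff accordion_vertex.simps using assms(2) by blast
  also have "(\<exists>j\<in>{1..n}. y = U j \<and> wrap n (j + 1) = i) \<longleftrightarrow> y = U ?p"
    using wrap_Suc_eq_iff[OF assms] p by blast
  finally show ?thesis by blast
qed

lemma accordion_arc_V_iff:
  assumes "3 \<le> n" "1 \<le> k" "k \<le> n" "i \<in> {1..n}"
  shows "(V i, y) \<in> parcs (accordion n k) \<longleftrightarrow>
    y \<in> {V (wrap n (i + 1)), V (if i = 1 then n else i - 1), U i,
      U (if i \<le> k then i + n - k else i - k)}"
proof -
  let ?p = "if i = 1 then n else i - 1" and ?l = "if i \<le> k then i + n - k else i - k"
  have p: "?p \<in> {1..n}" and l: "?l \<in> {1..n}" using assms by auto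
  have "(V i, y) \<in> parcs (accordion n k) \<longleftrightarrow>
      y = V (wrap n (i + 1)) \<or> (\<exists>j\<in>{1..n}. y = V j \<and> wrap n (j + 1) = i) \<or>
      y = U i \<or> (\<exists>j\<in>{1..n}. y = U j \<and> wrap n (j + k) = i)"
    unfolding accordion_arc_iff doubleton_eq_iff accordion_vertex.simps using assms(4) by blast
  also have "(\<exists>j\<in>{1..n}. y = V j \<and> wrap n (j + 1) = i) \<longleftrightarrow> y = V ?p"
    using wrap_Suc_eq_iff[OF assms(1,4)] p by blast
  also have "(\<exists>j\<in>{1..n}. y = U j \<and> wrap n (j + k) = i) \<longleftrightarrow> y = U ?l"
    using wrap_add_eq_iff[OF assms(2-4)] l by blast
  finally show ?thesis by blast
qed

lemma accordion_4_regular: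
  assumes "3 \<le> n" "1 \<le> k" "2 * k \<le> n" "x \<in> accordion_verts n"
  shows "out_degree (with_proj (accordion n k)) x = 4"
proof -
  let ?N = "{y. (x, y) \<in> parcs (accordion n k)}"
  have arcs: "out_arcs (with_proj (accordion n k)) x = Pair x ` ?N"
    by (auto simp: out_arcs_def)
  have "card ?N = 4"
  proof (cases x)
    case (U i)
    with assms have i: "i \<in> {1..n}" by (auto simp: accordion_verts_def)
    have "?N = {U (if i = n then 1 else i + 1), U (if i = 1 then n else i - 1), V i,
        V (if i + k \<le> n then i + k else i + k - n)}"
      using accordion_arc_U_iff[OF assms(1) i] wrap_Suc[OF i] wrap_add[OF i, of k] assms(3) U
      by auto
    then show ?thesis using assms i by (auto simp: card_insert_if)
  next
    case (V i)
    with assms have i: "i \<in> {1..n}" by (auto simp: accordion_verts_def)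
    have "?N = {V (if i = n then 1 else i + 1), V (if i = 1 then n else i - 1), U i,
        U (if i \<le> k then i + n - k else i - k)}"
      using accordion_arc_V_iff[OF assms(1,2) _ i] wrap_Suc[OF i] assms(3) V
      by auto
    then show ?thesis using assms i by (auto simp: card_insert_if)
  qed
  then show ?thesis
    by (simp add: out_degree_def arcs card_image inj_on_def)
qed

text \<open>
  On graphs given by arc pairs, \<^const>\<open>digraph_iso\<close> is the usual notion of isomorphism: a bijection
  of the vertex sets that preserves and reflects adjacency.
\<close>

lemma digraph_iso_pair_iff:
  fixes G :: "'a pair_pre_digraph" and H :: "'b pair_pre_digraph"
  assumes "pair_wf_digraph G" "pair_wf_digraph H"
  shows "digraph_iso (with_proj G) (with_proj H) \<longleftrightarrow>
    (\<exists>f. bij_betw f (pverts G) (pverts H) \<and>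
      (\<forall>x\<in>pverts G. \<forall>y\<in>pverts G. (x, y) \<in> parcs G \<longleftrightarrow> (f x, f y) \<in> parcs H))"
proof
  interpret G: pair_wf_digraph G by fact
  assume "digraph_iso (with_proj G) (with_proj H)"
  then obtain h where h: "pre_digraph.digraph_isomorphism (with_proj G) h"
    and H: "with_proj H = app_iso h (with_proj G)"
    unfolding digraph_iso_def by blast
  let ?f = "iso_verts h"
  have verts: "pverts H = ?f ` pverts G" and arcs: "parcs H = iso_arcs h ` parcs G"
    and ends: "iso_tail h = fst" "iso_head h = snd"
    using arg_cong[OF H, of verts] arg_cong[OF H, of arcs]
      arg_cong[OF H, of tail] arg_cong[OF H, of head] by simp_all
  have inj: "inj_on ?f (pverts G)"
    using h by (simp add: pre_digraph.digraph_isomorphism_def)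
  have arc: "iso_arcs h (x, y) = (?f x, ?f y)" if "(x, y) \<in> parcs G" for x y
    using h that ends by (fastforce simp: pre_digraph.digraph_isomorphism_def prod_eq_iff)
  have "(x, y) \<in> parcs G \<longleftrightarrow> (?f x, ?f y) \<in> parcs H" if xy: "x \<in> pverts G" "y \<in> pverts G" for x y
  proof
    show "(x, y) \<in> parcs G \<Longrightarrow> (?f x, ?f y) \<in> parcs H"
      using arc arcs by (metis image_eqI)
    assume "(?f x, ?f y) \<in> parcs H"
    then obtain p q where pq: "(p, q) \<in> parcs G" "(?f x, ?f y) = iso_arcs h (p, q)"
      using arcs by auto
    then have "?f x = ?f p" "?f y = ?f q" using arc by auto
    then have "x = p" "y = q"
      using inj xy pq(1) G.in_arcsD1 G.in_arcsD2 by (auto dest: inj_onD)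
    then show "(x, y) \<in> parcs G" using pq by simp
  qed
  then show "\<exists>f. bij_betw f (pverts G) (pverts H) \<and>
      (\<forall>x\<in>pverts G. \<forall>y\<in>pverts G. (x, y) \<in> parcs G \<longleftrightarrow> (f x, f y) \<in> parcs H)"
    using inj verts by (intro exI[of _ ?f]) (auto simp: bij_betw_def)
next
  interpret G: pair_wf_digraph G by fact
  interpret H: pair_wf_digraph H by fact
  assume "\<exists>f. bij_betw f (pverts G) (pverts H) \<and>
      (\<forall>x\<in>pverts G. \<forall>y\<in>pverts G. (x, y) \<in> parcs G \<longleftrightarrow> (f x, f y) \<in> parcs H)"
  then obtain f where f: "inj_on f (pverts G)" "f ` pverts G = pverts H"
    and adj: "\<And>x y. x \<in> pverts G \<Longrightarrow> y \<in> pverts G \<Longrightarrow>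
      (x, y) \<in> parcs G \<longleftrightarrow> (f x, f y) \<in> parcs H"
    by (auto simp: bij_betw_def)
  let ?h = "\<lparr>iso_verts = f, iso_arcs = map_prod f f, iso_head = snd, iso_tail = fst\<rparr>"
  have "parcs G \<subseteq> pverts G \<times> pverts G"
    using G.in_arcsD1 G.in_arcsD2 by auto
  then have "inj_on (map_prod f f) (parcs G)"
    using f(1) by (auto simp: inj_on_def subset_iff)
  then have "pre_digraph.digraph_isomorphism (with_proj G) ?h"
    using f(1) G.wf_digraph by (simp add: pre_digraph.digraph_isomorphism_def)
  moreover have "map_prod f f ` parcs G = parcs H"
  proof (intro equalityI subsetI)
    fix e assume "e \<in> map_prod f f ` parcs G"
    then obtain x y where "(x, y) \<in> parcs G" "e = (f x, f y)" by auto
    then show "e \<in> parcs H" using adj G.in_arcsD1 G.in_arcsD2 by metis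
  next
    fix e assume e: "e \<in> parcs H"
    obtain a b where ab: "e = (a, b)" by (cases e)
    then obtain p q where pq: "p \<in> pverts G" "q \<in> pverts G" "a = f p" "b = f q"
      using e f(2) H.in_arcsD1 H.in_arcsD2 by blast
    then have "(p, q) \<in> parcs G"
      using e ab adj by simp
    then show "e \<in> map_prod f f ` parcs G"
      using ab pq by (metis image_eqI map_prod_simp)
  qed
  then have "with_proj H = app_iso ?h (with_proj G)"
    using f(2) by (simp add: app_iso_def with_proj_def)
  ultimately show "digraph_iso (with_proj G) (with_proj H)"
    unfolding digraph_iso_def by blast
qed

end

theory Submission
  imports Defs "HOL-Library.Product_Plus"
begin

text \<open>
  Every vertex of \<open>A[n, k]\<close> lies on four squares that close up around it, so \<open>A[n, k]\<close> is the
  quotient of the grid \<open>\<int>\<^sup>2\<close> by the lattice \<open>L\<close> generated by \<open>(n, 0)\<close> and \<open>(k, 2)\<close>. For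
  \<open>3 \<le> k < n / 2\<close> the lattice has no nonzero vector of \<open>l\<^sub>1\<close>-norm at most 4, so a path \<open>a, x, b\<close> is
  straight in the grid exactly if \<open>x\<close> is the only common neighbour of \<open>a\<close> and \<open>b\<close>; the backward implication
  holds for \<open>k = n / 2\<close> as well, where \<open>(0, 4) \<in> L\<close>. For \<open>k\<^sub>1 \<ge> 3\<close> an isomorphism therefore
  preserves straightness and lifts to a symmetry of the grid carrying \<open>L\<^sub>1\<close> into
  \<open>L\<^sub>2\<close>. If it keeps the axes, then \<open>k\<^sub>1 \<equiv> \<plusminus>k\<^sub>2\<close> modulo \<open>n\<close>, which is impossible; if it exchanges
  them, then \<open>(0, n)\<close> and \<open>(2, \<plusminus>k\<^sub>1)\<close> lie in \<open>L\<^sub>2\<close>, which is the arithmetic condition. Conversely,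
  under that condition an exchange of the axes carries \<open>L\<^sub>1\<close> onto \<open>L\<^sub>2\<close>. The values \<open>k\<^sub>1 = 1\<close> (the
  graph has triangles) and \<open>k\<^sub>1 = 2\<close> (no path has a unique middle vertex) are excluded separately.
\<close>

section \<open>The grid and its projection to the accordion graph\<close>

definition residue :: "nat \<Rightarrow> int \<Rightarrow> nat" where
  "residue n z = wrap n (nat (z mod int n))"

text \<open>
  Even rows of the grid wind around the cycle of the \<open>u\<^sub>i\<close>, odd rows around that of the \<open>v\<^sub>i\<close>; two
  steps up lead along the edges \<open>u\<^sub>x v\<^sub>x\<close> and \<open>v\<^sub>x u\<^sub>x\<^sub>-\<^sub>k\<close>, hence the shift by \<open>k\<close> every second row.
\<close>

definition torus :: "nat \<Rightarrow> nat \<Rightarrow> int \<times> int \<Rightarrow> accordion_vertex" where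
  "torus n k = (\<lambda>(x, y). (if even y then U else V) (residue n (x - y div 2 * int k)))"

text \<open>Exactly the integer combinations of \<open>(n, 0)\<close> and \<open>(k, 2)\<close>, the
  coefficient of \<open>(k, 2)\<close> being \<open>y div 2\<close>.\<close>

definition period_lattice :: "nat \<Rightarrow> nat \<Rightarrow> (int \<times> int) set" where
  "period_lattice n k = {(x, y). even y \<and> int n dvd x - y div 2 * int k}"

definition unit_steps :: "(int \<times> int) set" where
  "unit_steps = {(1, 0), (-1, 0), (0, 1), (0, -1)}"

definition perp :: "int \<times> int \<Rightarrow> int \<times> int \<Rightarrow> bool" where
  "perp d e \<longleftrightarrow> d \<in> unit_steps \<and> e \<in> unit_steps \<and> e \<noteq> d \<and> e \<noteq> - d"

lemma residue_in: "0 < n \<Longrightarrow> residue n z \<in> {1..n}"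
  unfolding residue_def by (rule wrap_in)

lemma residue_cong: "0 < n \<Longrightarrow> [int (residue n z) = z] (mod int n)"
proof -
  assume n: "0 < n"
  then have "nat (z mod int n) < n" by (simp add: nat_less_iff)
  moreover have "0 \<le> z mod int n" using n by simp
  ultimately show ?thesis using n by (auto simp: residue_def wrap_def cong_def intro: order.antisym)
qed

lemma residue_eqI:
  assumes "j \<in> {1..n}" "[int j = z] (mod int n)"
  shows "residue n z = j"
proof -
  have "z mod int n = int (j mod n)"
    using assms(2) by (simp add: cong_def zmod_int)
  then have "residue n z = wrap n j"
    by (simp add: residue_def wrap_def)
  then show ?thesis
    using wrap_id[OF assms(1)] by simp
qed

lemma residue_eq_iff:
  assumes "0 < n"
  shows "residue n z = residue n w \<longleftrightarrow> int n dvd z - w"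
  by (metis assms cong_iff_dvd_diff cong_sym cong_trans residue_cong residue_eqI residue_in)

lemma wrap_eq_residue: "wrap n i = residue n (int i)"
  by (simp add: residue_def wrap_def flip: zmod_int)

lemma residue_residue_add:
  assumes "0 < n"
  shows "residue n (int (residue n z) + m) = residue n (z + m)"
  using residue_cong[OF assms, of z] by (simp add: residue_eq_iff[OF assms] cong_iff_dvd_diff)

text \<open>Rows of different parity go to different cycles, and for rows of equal parity halving
  commutes with the difference; so the fibres are the cosets of the lattice.\<close>

lemma torus_eq_iff:
  assumes "0 < n"
  shows "torus n k a = torus n k b \<longleftrightarrow> a - b \<in> period_lattice n k"
proof -
  obtain x y x' y' where ab: "a = (x, y)" "b = (x', y')" by fastforce
  have *: "x - y div 2 * int k - (x' - y' div 2 * int k) = x - x' - (y - y') div 2 * int k"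
    if "even y \<longleftrightarrow> even y'"
  proof -
    have "y div 2 = y' div 2 + (y - y') div 2" using that by presburger
    then show ?thesis by (subst \<open>y div 2 = _\<close>) (simp add: algebra_simps)
  qed
  show ?thesis
    by (auto simp: ab torus_def period_lattice_def residue_eq_iff[OF assms] * )
qed

lemma torus_surj:
  assumes "0 < n"
  shows "range (torus n k) = accordion_verts n"
proof
  show "range (torus n k) \<subseteq> accordion_verts n"
    using residue_in[OF assms] by (auto simp: torus_def accordion_verts_def)
  have "U i = torus n k (int i, 0)" "V i = torus n k (int i, 1)" if "i \<in> {1..n}" for i
    using that by (simp_all add: torus_def residue_eqI)
  then show "accordion_verts n \<subseteq> range (torus n k)"
    unfolding accordion_verts_def by blast
qed

text \<open>\<open>y div 2\<close> changes only in a step up from an odd row or down from an even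
  one. These steps give the edges shifted by \<open>k\<close>, the other vertical steps the edges
  joining \<open>U i\<close> and \<open>V i\<close>.\<close>

lemma torus_arc_iff:
  assumes "3 \<le> n" "1 \<le> k" "k \<le> n"
  shows "(torus n k a, w) \<in> parcs (accordion n k) \<longleftrightarrow>
    w \<in> (\<lambda>d. torus n k (a + d)) ` unit_steps"
proof -
  obtain x y where a: "a = (x, y)" by fastforce
  have n: "0 < n" using assms by simp
  define z i where "z = x - y div 2 * int k" and "i = residue n z"
  have i: "i \<in> {1..n}" using residue_in[OF n] i_def by simp
  have pred: "(if i = 1 then n else i - 1) = residue n (z - 1)"
    unfolding i_def residue_residue_add[OF n, of z "-1", simplified, symmetric]
    using i by (intro residue_eqI[symmetric]) (auto simp: i_def cong_iff_dvd_diff)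
  have sub: "(if i \<le> k then i + n - k else i - k) = residue n (z - int k)"
    unfolding i_def residue_residue_add[OF n, of z "- int k", simplified, symmetric]
    using i assms by (intro residue_eqI[symmetric]) (auto simp: i_def cong_iff_dvd_diff of_nat_diff)
  have add: "wrap n (i + m) = residue n (z + int m)" for m
    using residue_residue_add[OF n, of z "int m"] by (simp add: i_def wrap_eq_residue)
  show ?thesis
  proof (cases "even y")
    case True
    then have "torus n k a = U i" "torus n k (a + (1, 0)) = U (residue n (z + 1))"
      "torus n k (a + (-1, 0)) = U (residue n (z - 1))" "torus n k (a + (0, 1)) = V i"
      by (auto simp: a torus_def z_def i_def algebra_simps)
    moreover have "torus n k (a + (0, -1)) = V (residue n (z + int k))"
    proof -
      have *: "(y + - 1) div 2 = y div 2 - 1" using True by presburger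
      have "x - (y + - 1) div 2 * int k = z + int k"
        unfolding * z_def by (simp add: algebra_simps)
      then show ?thesis using True by (simp add: a torus_def)
    qed
    ultimately show ?thesis
      using accordion_arc_U_iff[OF assms(1) i, of w k]
      unfolding pred add unit_steps_def by auto
  next
    case False
    then have "torus n k a = V i" "torus n k (a + (1, 0)) = V (residue n (z + 1))"
      "torus n k (a + (-1, 0)) = V (residue n (z - 1))"
      by (auto simp: a torus_def z_def i_def algebra_simps)
    moreover have "torus n k (a + (0, -1)) = U i"
    proof -
      have "(y + - 1) div 2 = y div 2" using False by presburger
      then show ?thesis using False by (simp add: a torus_def z_def i_def algebra_simps)
    qed
    moreover have "torus n k (a + (0, 1)) = U (residue n (z - int k))"
    proof -
      have *: "(y + 1) div 2 = y div 2 + 1" using False by presburger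
      have "x - (y + 1) div 2 * int k = z - int k"
        unfolding * z_def by (simp add: algebra_simps)
      then show ?thesis using False by (simp add: a torus_def)
    qed
    ultimately show ?thesis
      using accordion_arc_V_iff[OF assms i, of w]
      unfolding pred sub add unit_steps_def by auto
  qed
qed

lemma torus_arc:
  assumes "3 \<le> n" "1 \<le> k" "k \<le> n" "d \<in> unit_steps" "b = a + d"
  shows "(torus n k a, torus n k b) \<in> parcs (accordion n k)"
  using assms by (simp add: torus_arc_iff)

lemma torus_arcE:
  assumes "3 \<le> n" "1 \<le> k" "k \<le> n" "(torus n k a, z) \<in> parcs (accordion n k)"
  obtains d where "d \<in> unit_steps" "z = torus n k (a + d)"
  using assms by (auto simp: torus_arc_iff)

section \<open>Short vectors of the lattice\<close>

lemma small_multiple_eq_0: "int n dvd z \<Longrightarrow> \<bar>z\<bar> < int n \<Longrightarrow> z = 0"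
  by (metis abs_of_nat dvd_imp_le_int not_less)

text \<open>Here \<open>y = 2 * m\<close> with \<open>m\<close> between -2 and 2, and
  \<open>x\<close> is congruent to \<open>m * k\<close> modulo \<open>n\<close>. An \<open>m\<close>
  of absolute value 1 would need \<open>x\<close> of absolute value at least 3; absolute value 2
  forces \<open>x = 0\<close>, so \<open>n\<close> divides \<open>2 * k\<close>.\<close>

lemma period_lattice_short:
  assumes "(x, y) \<in> period_lattice n k" "\<bar>x\<bar> + \<bar>y\<bar> \<le> 4" "3 \<le> k" "2 * k \<le> n"
  shows "x = 0 \<and> (y = 0 \<or> \<bar>y\<bar> = 4 \<and> 2 * k = n)"
proof -
  have y: "even y" and d: "int n dvd x - y div 2 * int k"
    using assms(1) by (auto simp: period_lattice_def)
  have k: "3 \<le> int k" "2 * int k \<le> int n" using assms(3,4) by auto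
  have "\<bar>y\<bar> \<le> 4" using assms(2) by linarith
  then have "y \<in> {0, 2, -2, 4, -4}" using y by (auto elim!: evenE)
  then consider "y = 0" | "y = 2" | "y = -2" | "y = 4" | "y = -4"
    by blast
  then show ?thesis
  proof cases
    case 1
    then show ?thesis using d small_multiple_eq_0[of n x] k assms(2) by auto
  next
    case 2
    have "x - int k = 0"
    proof (rule small_multiple_eq_0)
      show "int n dvd x - int k" using d 2 by simp
      show "\<bar>x - int k\<bar> < int n" using k assms(2) 2 by linarith
    qed
    then show ?thesis using 2 k assms(2) by linarith
  next
    case 3
    have "x + int k = 0"
    proof (rule small_multiple_eq_0)
      show "int n dvd x + int k" using d 3 by simp
      show "\<bar>x + int k\<bar> < int n" using k assms(2) 3 by linarith
    qed
    then show ?thesis using 3 k assms(2) by linarith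
  next
    case 4
    then have "x = 0" "int n dvd 2 * int k" using d assms(2) by auto
    then show ?thesis using 4 small_multiple_eq_0[of n "2 * int k"] k by (cases "2 * k = n") auto
  next
    case 5
    then have "x = 0" "int n dvd 2 * int k" using d assms(2) by auto
    then show ?thesis using 5 small_multiple_eq_0[of n "2 * int k"] k by (cases "2 * k = n") auto
  qed
qed

lemma unit_steps_diff_not_in_lattice:
  assumes "4 \<le> k" "2 * k \<le> n" "d \<in> unit_steps" "e \<in> unit_steps" "d - e \<in> period_lattice n k"
  shows "d = e"
proof -
  obtain x y x' y' where "d = (x, y)" "e = (x', y')" by fastforce
  then show ?thesis
    using assms period_lattice_short[of "x - x'" "y - y'" n k]
    by (auto simp: unit_steps_def)
qed

text \<open>The norm is at most 4, and since \<open>d\<close> and \<open>e\<close> lie on different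
  axes the vector is neither zero nor \<open>(0, 4)\<close> nor \<open>(0, -4)\<close>. In
  \<open>frame_step\<close> it measures how far a wrongly oriented square is from closing.\<close>

lemma unit_add_double_diff_not_in_lattice:
  assumes "3 \<le> k" "2 * k \<le> n" "perp d e" "u \<in> unit_steps"
  shows "u + e + e - d \<notin> period_lattice n k"
proof -
  obtain x y x' y' v w where "d = (x, y)" "e = (x', y')" "u = (v, w)" by fastforce
  then show ?thesis
    using assms period_lattice_short[of "v + x' + x' - x" "w + y' + y' - y" n k]
    by (auto simp: perp_def unit_steps_def)
qed

section \<open>Straight paths and common neighbours\<close>

definition sole_common_nbr :: "'a pair_pre_digraph \<Rightarrow> 'a \<Rightarrow> 'a \<Rightarrow> 'a \<Rightarrow> bool" where
  "sole_common_nbr G x a b \<longleftrightarrow>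
    a \<noteq> b \<and> {z. (a, z) \<in> parcs G \<and> (b, z) \<in> parcs G} = {x}"

text \<open>If the path bends at \<open>a\<close>, the fourth corner \<open>a + d + e\<close> of the
  square is another common neighbour: \<open>d + e\<close> has an odd second coordinate and so is no
  period.\<close>

lemma sole_common_nbr_straight:
  assumes "3 \<le> n" "2 \<le> k" "2 * k \<le> n" "d \<in> unit_steps" "e \<in> unit_steps"
    and "sole_common_nbr (accordion n k) (torus n k a) (torus n k (a + d)) (torus n k (a + e))"
  shows "e = - d"
proof (rule ccontr)
  assume "e \<noteq> - d"
  have n: "0 < n" and k: "1 \<le> k" "k \<le> n" using assms by auto
  have "e \<noteq> d" using assms(6) by (auto simp: sole_common_nbr_def)
  have "torus n k (a + d + e) = torus n k a"
  proof -
    have "(torus n k (a + d), torus n k (a + d + e)) \<in> parcs (accordion n k)"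
      "(torus n k (a + e), torus n k (a + d + e)) \<in> parcs (accordion n k)"
      by (rule torus_arc[OF assms(1) k assms(5)] torus_arc[OF assms(1) k assms(4)], simp add: add_ac)+
    then show ?thesis
      using assms(6) unfolding sole_common_nbr_def by blast
  qed
  then have "d + e \<in> period_lattice n k"
    unfolding torus_eq_iff[OF n] by (simp add: algebra_simps)
  moreover have "perp d e"
    using assms(4,5) \<open>e \<noteq> d\<close> \<open>e \<noteq> - d\<close> by (simp add: perp_def)
  ultimately show False
    by (auto simp: perp_def unit_steps_def period_lattice_def)
qed

text \<open>A common neighbour is the image of some \<open>a + d + u\<close> and some
  \<open>a - d + v\<close>; their difference has norm at most 4, so it vanishes and
  \<open>u = - d\<close>. For \<open>2 * k = n\<close> and vertical \<open>d\<close> the period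
  \<open>(0, 4)\<close> makes \<open>a + d + d\<close> a second common neighbour, hence the last
  hypothesis.\<close>

lemma straight_sole_common_nbr:
  assumes "3 \<le> k" "2 * k \<le> n" "d \<in> unit_steps" "2 * k < n \<or> snd d = 0"
  shows "sole_common_nbr (accordion n k) (torus n k a) (torus n k (a + d)) (torus n k (a - d))"
proof -
  have n: "0 < n" "3 \<le> n" and k: "1 \<le> k" "k \<le> n" using assms by auto
  obtain x y where d: "d = (x, y)" by fastforce
  have ne: "d + d \<notin> period_lattice n k"
    using assms period_lattice_short[of "x + x" "y + y" n k]
    by (auto simp: d unit_steps_def)
  have opp: "u = - d" if "u \<in> unit_steps" "v \<in> unit_steps" "d + u - (v - d) \<in> period_lattice n k"
    for u v
  proof -
    obtain p q r s where uv: "u = (p, q)" "v = (r, s)" by fastforce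
    show ?thesis
      using that assms period_lattice_short[of "x + p - (r - x)" "y + q - (s - y)" n k]
      by (auto simp: uv d unit_steps_def)
  qed
  have d': "- d \<in> unit_steps" using assms(3) by (auto simp: unit_steps_def)
  have "z = torus n k a"
    if z: "(torus n k (a + d), z) \<in> parcs (accordion n k)"
      "(torus n k (a - d), z) \<in> parcs (accordion n k)"
    for z
  proof -
    obtain u where u: "u \<in> unit_steps" "z = torus n k (a + d + u)"
      using torus_arcE[OF n(2) k z(1)] by metis
    obtain v where v: "v \<in> unit_steps" "z = torus n k (a - d + v)"
      using torus_arcE[OF n(2) k z(2)] by metis
    have "d + u - (v - d) \<in> period_lattice n k"
      using u v torus_eq_iff[OF n(1), of k "a + d + u" "a - d + v"] by (simp add: algebra_simps)
    then have "u = - d" using opp u(1) v(1) by blast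
    then show ?thesis using u(2) by simp
  qed
  moreover have "(torus n k (a + d), torus n k a) \<in> parcs (accordion n k)"
    "(torus n k (a - d), torus n k a) \<in> parcs (accordion n k)"
    by (auto intro: torus_arc[OF n(2) k d'] torus_arc[OF n(2) k assms(3)])
  moreover have "torus n k (a + d) \<noteq> torus n k (a - d)"
    using ne by (simp add: torus_eq_iff[OF n(1)])
  ultimately show ?thesis unfolding sole_common_nbr_def by blast
qed

lemma not_sole_common_nbr_2:
  assumes "4 \<le> n" "d \<in> unit_steps" "e \<in> unit_steps"
  shows "\<not> sole_common_nbr (accordion n 2) (torus n 2 a) (torus n 2 (a + d)) (torus n 2 (a + e))"
proof
  assume sole: "sole_common_nbr (accordion n 2) (torus n 2 a) (torus n 2 (a + d)) (torus n 2 (a + e))"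
  have n: "0 < n" "3 \<le> n" using assms by auto
  have e: "e = - d"
    using sole_common_nbr_straight[OF n(2) _ _ assms(2,3) sole] assms(1) by simp
  \<comment> \<open>Reflecting \<open>d\<close> in the diagonal makes \<open>d + c\<close> equal to
    \<open>(1, 1)\<close> or its negative. As \<open>(2, 2)\<close> is a period for
    \<open>k = 2\<close>, sidesteps from both ends meet in a second common neighbour.\<close>
  define c where "c = (snd d, fst d)"
  have c: "c \<in> unit_steps" "- c \<in> unit_steps"
    using assms(2) by (auto simp: c_def unit_steps_def)
  have eq: "torus n 2 (a + d + c) = torus n 2 (a + e + - c)"
    and ne: "torus n 2 (a + d + c) \<noteq> torus n 2 a"
    using assms(2) unfolding torus_eq_iff[OF n(1)] e c_def
    by (auto simp: unit_steps_def period_lattice_def)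
  have "(torus n 2 (a + d), torus n 2 (a + d + c)) \<in> parcs (accordion n 2)"
    using n(2) c(1) by (intro torus_arc[OF _ _ _ c(1)]) auto
  moreover have "(torus n 2 (a + e), torus n 2 (a + d + c)) \<in> parcs (accordion n 2)"
    unfolding eq using n(2) by (intro torus_arc[OF _ _ _ c(2)]) auto
  ultimately show False
    using sole ne unfolding sole_common_nbr_def by blast
qed

section \<open>Triangles\<close>

lemma triangle_1:
  assumes "3 \<le> n"
  obtains x y z where "(x, y) \<in> parcs (accordion n 1)" "(y, z) \<in> parcs (accordion n 1)"
    "(z, x) \<in> parcs (accordion n 1)"
proof -
  have n: "0 < n" using assms by simp
  let ?t = "torus n 1"
  have "(?t (0, 0), ?t (0, 1)) \<in> parcs (accordion n 1)"
    by (rule torus_arc[where d = "(0, 1)"]) (use assms in \<open>auto simp: unit_steps_def\<close>)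
  moreover have "(?t (0, 1), ?t (0, 2)) \<in> parcs (accordion n 1)"
    by (rule torus_arc[where d = "(0, 1)"]) (use assms in \<open>auto simp: unit_steps_def\<close>)
  moreover have "(?t (0, 2), ?t (1, 2)) \<in> parcs (accordion n 1)"
    by (rule torus_arc[where d = "(1, 0)"]) (use assms in \<open>auto simp: unit_steps_def\<close>)
  \<comment> \<open>For \<open>k = 1\<close> the generator \<open>(k, 2)\<close> is itself a walk of
    three steps.\<close>
  moreover have "?t (1, 2) = ?t (0, 0)"
    unfolding torus_eq_iff[OF n] by (simp add: period_lattice_def)
  ultimately show ?thesis using that by metis
qed

text \<open>A triangle would give a period of odd norm at most 3. Its second coordinate is 0, 2 or
  -2, so its first is odd and small, and \<open>n >= 4\<close> or \<open>k >= 2\<close> rules it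
  out.\<close>

lemma no_triangle:
  assumes "2 \<le> k" "2 * k \<le> n" "4 \<le> n"
    "(x, y) \<in> parcs (accordion n k)" "(y, z) \<in> parcs (accordion n k)" "(z, x) \<in> parcs (accordion n k)"
  shows False
proof -
  have n: "0 < n" "3 \<le> n" and k: "1 \<le> k" "k \<le> n" using assms by auto
  interpret pair_graph "accordion n k" using pair_graph_accordion[OF n(2)] .
  have "x \<in> accordion_verts n"
    using in_arcsD1[OF assms(4)] by (simp add: accordion_def)
  then obtain a where x: "x = torus n k a" using torus_surj[OF n(1)] by blast
  then obtain d where d: "d \<in> unit_steps" "y = torus n k (a + d)"
    using torus_arcE[OF n(2) k] assms(4) by metis
  then obtain e where e: "e \<in> unit_steps" "z = torus n k (a + d + e)"
    using torus_arcE[OF n(2) k] assms(5) by metis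
  then obtain c where c: "c \<in> unit_steps" "x = torus n k (a + d + e + c)"
    using torus_arcE[OF n(2) k] assms(6) by metis
  then have L: "d + e + c \<in> period_lattice n k"
    using torus_eq_iff[OF n(1), of k "a + d + e + c" a] x by (simp add: algebra_simps)
  obtain p q where pq: "d + e + c = (p, q)" by fastforce
  then have odd: "odd (p + q)" and short: "\<bar>p\<bar> + \<bar>q\<bar> \<le> 3"
    using c(1) d(1) e(1) by (auto simp: unit_steps_def)
  have k': "2 \<le> int k" "2 * int k \<le> int n" using assms(1,2) by auto
  have q: "even q" and dvd: "int n dvd p - q div 2 * int k"
    using L pq by (auto simp: period_lattice_def)
  have "\<bar>q\<bar> \<le> 3" using short by linarith
  then have "q \<in> {0, 2, -2}" using q by (auto elim!: evenE)
  then consider "q = 0" | "q = 2" | "q = -2" by blast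
  then show False
  proof cases
    case 1
    then have "\<bar>p\<bar> = 3 \<or> \<bar>p\<bar> = 1" using odd short by presburger
    then show False using 1 dvd k' small_multiple_eq_0[of n p] by auto
  next
    case 2
    then have "\<bar>p\<bar> = 1" using odd short by presburger
    then have "\<bar>p - int k\<bar> < int n" "p - int k \<noteq> 0" using k' by linarith+
    then show False using 2 dvd small_multiple_eq_0[of n "p - int k"] by simp
  next
    case 3
    then have "\<bar>p\<bar> = 1" using odd short by presburger
    then have "\<bar>p + int k\<bar> < int n" "p + int k \<noteq> 0" using k' by linarith+
    then show False using 3 dvd small_multiple_eq_0[of n "p + int k"] by simp
  qed
qed

section \<open>Propagating rigid motions over the grid\<close>

text \<open>
  \<open>F\<close> is the lift of an isomorphism to the grid: near \<open>a\<close> it acts as the rigid motion with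
  \<open>a \<mapsto> c\<close>, \<open>e \<mapsto> d\<close>, \<open>e' \<mapsto> d'\<close>.
\<close>

definition frame ::
  "(int \<times> int \<Rightarrow> 'a) \<Rightarrow> (int \<times> int \<Rightarrow> 'a) \<Rightarrow> int \<times> int \<Rightarrow> int \<times> int \<Rightarrow>
    int \<times> int \<Rightarrow> int \<times> int \<Rightarrow> int \<times> int \<Rightarrow> int \<times> int \<Rightarrow> bool"
  where "frame F P e e' a c d d' \<longleftrightarrow> perp d d' \<and> F a = P c \<and> F (a + e) = P (c + d) \<and>
    F (a - e) = P (c - d) \<and> F (a + e') = P (c + d') \<and> F (a - e') = P (c - d')"

lemma uminus_unit_steps: "d \<in> unit_steps \<Longrightarrow> - d \<in> unit_steps"
  by (auto simp: unit_steps_def)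

lemma perp_neg: "perp d e \<Longrightarrow> perp (- d) e"
  by (simp add: perp_def uminus_unit_steps)

lemma perp_commute: "perp d e \<Longrightarrow> perp e d"
  unfolding perp_def by (metis minus_minus)

lemma perp_unique: "perp d e \<Longrightarrow> perp d e' \<Longrightarrow> e' = e \<or> e' = - e"
  unfolding perp_def unit_steps_def by (elim conjE insertE; simp)

lemma frame_neg: "frame F P e e' a c d d' \<Longrightarrow> frame F P (- e) e' a c (- d) d'"
  by (simp add: frame_def perp_neg)

lemma frame_commute: "frame F P e e' a c d d' \<Longrightarrow> frame F P e' e a c d' d"
  unfolding frame_def by (blast intro: perp_commute)

text \<open>Some frame exists at \<open>a + e\<close>. Its first direction must be \<open>d\<close>
  because \<open>F a\<close> is known, which leaves only the sign of the second.\<close>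

lemma frame_step:
  assumes k: "4 \<le> k" "2 * k \<le> n"
    and ex: "\<And>a c. F a = torus n k c \<Longrightarrow> \<exists>d d'. frame F (torus n k) e e' a c d d'"
    and fr: "frame F (torus n k) e e' a c d d'"
  shows "frame F (torus n k) e e' (a + e) (c + d) d d'"
proof -
  have n: "0 < n" using k by simp
  note eq_iff = torus_eq_iff[OF n]
  obtain b b' where b: "frame F (torus n k) e e' (a + e) (c + d) b b'"
    using ex fr unfolding frame_def by metis
  have "torus n k (c + d - b) = torus n k c"
    using b fr by (simp add: frame_def)
  then have "d - b \<in> period_lattice n k"
    by (simp add: eq_iff algebra_simps)
  then have [simp]: "b = d"
    using unit_steps_diff_not_in_lattice[OF k, of d b] b fr by (auto simp: frame_def perp_def)
  \<comment> \<open>With the opposite orientation at \<open>a + e\<close>, the image of the square spanned by \<open>e\<close> and \<open>e'\<close>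
    would not close up.\<close>
  have "b' \<noteq> - d'"
  proof
    assume "b' = - d'"
    then have 1: "F (a + e + e') = torus n k (c + d - d')"
      using b by (simp add: frame_def)
    obtain u where u: "u \<in> unit_steps" "F (a + e' + e) = torus n k (c + d' + u)"
      using ex[of "a + e'" "c + d'"] fr unfolding frame_def perp_def by metis
    then have "u + d' + d' - d \<in> period_lattice n k"
      using 1 eq_iff[of k "c + d' + u" "c + d - d'"] by (simp add: algebra_simps)
    then show False
      using unit_add_double_diff_not_in_lattice[of k n d d' u] k u fr by (simp add: frame_def)
  qed
  then have "b' = d'"
    using perp_unique[of d d' b'] b fr by (auto simp: frame_def)
  then show ?thesis using b by simp
qed

definition scale :: "int \<Rightarrow> int \<times> int \<Rightarrow> int \<times> int" where
  "scale m = (\<lambda>(x, y). (m * x, m * y))"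

lemma frame_line:
  assumes k: "4 \<le> k" "2 * k \<le> n"
    and ex: "\<And>a c. F a = torus n k c \<Longrightarrow> \<exists>d d'. frame F (torus n k) e e' a c d d'"
    and fr: "frame F (torus n k) e e' a c d d'"
  shows "frame F (torus n k) e e' (a + scale m e) (c + scale m d) d d'"
proof (induction m rule: int_induct[where k = 0])
  case base
  then show ?case using fr by (simp add: scale_def case_prod_unfold flip: zero_prod_def)
next
  case (step1 i)
  have "scale (i + 1) z = scale i z + z" for z
    by (cases z) (simp add: scale_def algebra_simps)
  then show ?case
    using frame_step[OF k ex step1(2)] by (simp add: add_ac)
next
  case (step2 i)
  have *: "scale (i - 1) z = scale i z - z" for z
    by (cases z) (simp add: scale_def algebra_simps)
  \<comment> \<open>A step backwards is a step forwards in the frame with \<open>e\<close> and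
    \<open>d\<close> negated.\<close>
  have ex': "\<exists>d d'. frame F (torus n k) (- e) e' a c d d'" if "F a = torus n k c" for a c
    using ex[OF that] frame_neg by blast
  show ?case
    using frame_neg[OF frame_step[OF k ex' frame_neg[OF step2(2)]]] by (simp add: * algebra_simps)
qed

lemma frame_grid:
  assumes k: "4 \<le> k" "2 * k \<le> n"
    and ex: "\<And>a c. F a = torus n k c \<Longrightarrow> \<exists>d d'. frame F (torus n k) (1, 0) (0, 1) a c d d'"
    and fr: "frame F (torus n k) (1, 0) (0, 1) (0, 0) c d d'"
  shows "F (x, y) = torus n k (c + scale x d + scale y d')"
proof -
  have ex': "\<exists>d d'. frame F (torus n k) (0, 1) (1, 0) a c d d'" if "F a = torus n k c" for a c
    using ex[OF that] frame_commute by blast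
  have "(x, y) = (0, 0) + scale x (1, 0) + scale y (0, 1)"
    by (simp add: scale_def)
  then show ?thesis
    using frame_line[OF k ex' frame_commute[OF frame_line[OF k ex fr, of x]], of y]
    by (simp add: frame_def)
qed

section \<open>Necessity: lifting an isomorphism\<close>

lemma sole_common_nbr_iso:
  assumes "pair_graph G" "pair_graph H" and bij: "bij_betw f (pverts G) (pverts H)"
    and adj: "\<And>x y. x \<in> pverts G \<Longrightarrow> y \<in> pverts G \<Longrightarrow> (x, y) \<in> parcs G \<longleftrightarrow> (f x, f y) \<in> parcs H"
    and "x \<in> pverts G" "a \<in> pverts G" "b \<in> pverts G"
  shows "sole_common_nbr H (f x) (f a) (f b) \<longleftrightarrow> sole_common_nbr G x a b"
proof -
  interpret G: pair_graph G by fact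
  interpret H: pair_graph H by fact
  let ?N = "\<lambda>G a b. {z. (a, z) \<in> parcs G \<and> (b, z) \<in> parcs G}"
  have sub: "?N G a b \<subseteq> pverts G" "?N H (f a) (f b) \<subseteq> pverts H"
    using G.in_arcsD2 H.in_arcsD2 by blast+
  have inj: "inj_on f (pverts G)" and surj: "f ` pverts G = pverts H"
    using bij by (auto simp: bij_betw_def)
  have "?N H (f a) (f b) = f ` ?N G a b"
  proof (intro equalityI subsetI)
    fix z assume z: "z \<in> ?N H (f a) (f b)"
    then obtain w where "w \<in> pverts G" "z = f w" using sub(2) surj by blast
    then show "z \<in> f ` ?N G a b" using z adj assms(6,7) by auto
  next
    fix z assume "z \<in> f ` ?N G a b"
    then show "z \<in> ?N H (f a) (f b)" using sub(1) adj assms(6,7) by blast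
  qed
  moreover have "f ` ?N G a b = {f x} \<longleftrightarrow> ?N G a b = {x}"
    using inj_on_image_eq_iff[OF inj sub(1), of "{x}"] assms(5) by simp
  moreover have "f a = f b \<longleftrightarrow> a = b"
    using inj assms(6,7) by (auto dest: inj_onD)
  ultimately show ?thesis by (simp add: sole_common_nbr_def)
qed

locale accordion_iso =
  fixes n k1 k2 :: nat and f :: "accordion_vertex \<Rightarrow> accordion_vertex"
  assumes n: "3 \<le> n" and k: "1 \<le> k1" "k1 < k2" "2 * k2 \<le> n"
    and bij: "bij_betw f (accordion_verts n) (accordion_verts n)"
    and adj: "x \<in> accordion_verts n \<Longrightarrow> y \<in> accordion_verts n \<Longrightarrow>
      (x, y) \<in> parcs (accordion n k1) \<longleftrightarrow> (f x, f y) \<in> parcs (accordion n k2)"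
begin

lemma n_pos: "0 < n" and k_le: "1 \<le> k1" "k1 \<le> n" "1 \<le> k2" "k2 \<le> n"
  using n k by auto

lemma torus_in: "torus n j a \<in> accordion_verts n"
  using torus_surj[OF n_pos, of j] by blast

lemma f_in: "x \<in> accordion_verts n \<Longrightarrow> f x \<in> accordion_verts n"
  using bij by (auto simp: bij_betw_def)

lemma f_surj: "y \<in> accordion_verts n \<Longrightarrow> \<exists>x\<in>accordion_verts n. y = f x"
  using bij by (auto simp: bij_betw_def)

lemma sole_iff:
  assumes "x \<in> accordion_verts n" "a \<in> accordion_verts n" "b \<in> accordion_verts n"
  shows "sole_common_nbr (accordion n k2) (f x) (f a) (f b) \<longleftrightarrow>
    sole_common_nbr (accordion n k1) x a b"
  using assms bij adj
  by (intro sole_common_nbr_iso pair_graph_accordion n) (simp_all add: accordion_def)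

lemma k1_ge_3: "3 \<le> k1"
proof -
  have "k1 \<noteq> 1"
  proof
    assume "k1 = 1"
    then obtain x y z where xyz: "(x, y) \<in> parcs (accordion n k1)"
      "(y, z) \<in> parcs (accordion n k1)" "(z, x) \<in> parcs (accordion n k1)"
      using triangle_1[OF n] by metis
    interpret G: pair_graph "accordion n k1" using pair_graph_accordion[OF n] .
    have "x \<in> accordion_verts n" "y \<in> accordion_verts n" "z \<in> accordion_verts n"
      using xyz[THEN G.in_arcsD1] by (simp_all add: accordion_def)
    then show False
      using no_triangle[of k2 n "f x" "f y" "f z"] xyz adj k by auto
  qed
  moreover have "k1 \<noteq> 2"
  proof
    assume k1: "k1 = 2"
    let ?t = "torus n k2"
    \<comment> \<open>A horizontal step, so that \<open>2 * k2 = n\<close> is covered too.\<close>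
    have d: "(1, 0) \<in> unit_steps" by (simp add: unit_steps_def)
    have sole: "sole_common_nbr (accordion n k2) (?t 0) (?t (0 + (1, 0))) (?t (0 - (1, 0)))"
      using k k1 d by (intro straight_sole_common_nbr) auto
    obtain x a b where xab: "x \<in> accordion_verts n" "a \<in> accordion_verts n" "b \<in> accordion_verts n"
      "?t 0 = f x" "?t (0 + (1, 0)) = f a" "?t (0 - (1, 0)) = f b"
      using f_surj[OF torus_in] by metis
    obtain p where p: "x = torus n 2 p"
      using xab(1) torus_surj[OF n_pos, of 2] by blast
    have "(?t 0, ?t (0 + (1, 0))) \<in> parcs (accordion n k2)" "(?t 0, ?t (0 - (1, 0))) \<in> parcs (accordion n k2)"
      by (rule torus_arc[OF n k_le(3,4) d] torus_arc[OF n k_le(3,4) uminus_unit_steps[OF d]]; simp)+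
    then have "(x, a) \<in> parcs (accordion n 2)" "(x, b) \<in> parcs (accordion n 2)"
      using adj xab k1 by auto
    then obtain d e where "d \<in> unit_steps" "a = torus n 2 (p + d)" "e \<in> unit_steps" "b = torus n 2 (p + e)"
      using torus_arcE[OF n, of 2 p] k_le k1 p by metis
    then show False
      using not_sole_common_nbr_2[of n d e p] sole xab p k1 k sole_iff by auto
  qed
  ultimately show ?thesis using k by linarith
qed

text \<open>Opposite neighbours stay opposite because \<open>f\<close> transports sole common
  neighbours. In the source \<open>2 * k1 < n\<close>, so vertical steps are admissible; in the
  target only the implication valid also for \<open>2 * k2 = n\<close> is used.\<close>

lemma straight_image:
  assumes "e \<in> unit_steps" "f (torus n k1 a) = torus n k2 c"
  obtains d where "d \<in> unit_steps" "f (torus n k1 (a + e)) = torus n k2 (c + d)"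
    "f (torus n k1 (a - e)) = torus n k2 (c - d)"
proof -
  have nbr: "\<exists>d\<in>unit_steps. f (torus n k1 (a + e)) = torus n k2 (c + d)" if "e \<in> unit_steps" for e
  proof -
    have "(torus n k1 a, torus n k1 (a + e)) \<in> parcs (accordion n k1)"
      using torus_arc[OF n k_le(1,2) that] by simp
    then have "(torus n k2 c, f (torus n k1 (a + e))) \<in> parcs (accordion n k2)"
      using adj torus_in assms(2) by metis
    then show ?thesis using torus_arcE[OF n k_le(3,4)] by metis
  qed
  obtain d where d: "d \<in> unit_steps" "f (torus n k1 (a + e)) = torus n k2 (c + d)"
    using nbr assms(1) by blast
  obtain d' where d': "d' \<in> unit_steps" "f (torus n k1 (a - e)) = torus n k2 (c + d')"
    using nbr[OF uminus_unit_steps[OF assms(1)]] by auto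
  have "sole_common_nbr (accordion n k1) (torus n k1 a) (torus n k1 (a + e)) (torus n k1 (a - e))"
    using k k1_ge_3 assms(1) by (intro straight_sole_common_nbr) auto
  then have "sole_common_nbr (accordion n k2) (torus n k2 c) (torus n k2 (c + d)) (torus n k2 (c + d'))"
    using sole_iff torus_in assms(2) d d' by metis
  then have "d' = - d"
    using k k1_ge_3 d d' n by (intro sole_common_nbr_straight) auto
  then show ?thesis using that d d' by simp
qed

lemma f_torus_eq_iff: "f (torus n k1 a) = f (torus n k1 b) \<longleftrightarrow> a - b \<in> period_lattice n k1"
  using bij torus_in unfolding torus_eq_iff[OF n_pos, symmetric] bij_betw_def
  by (metis inj_onD)

lemma ex_frame:
  assumes "f (torus n k1 a) = torus n k2 c"
  shows "\<exists>d d'. frame (\<lambda>a. f (torus n k1 a)) (torus n k2) (1, 0) (0, 1) a c d d'"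
proof -
  obtain d where d: "d \<in> unit_steps" "f (torus n k1 (a + (1, 0))) = torus n k2 (c + d)"
    "f (torus n k1 (a - (1, 0))) = torus n k2 (c - d)"
    using straight_image[OF _ assms, of "(1, 0)"] unfolding unit_steps_def by auto
  obtain e where e: "e \<in> unit_steps" "f (torus n k1 (a + (0, 1))) = torus n k2 (c + e)"
    "f (torus n k1 (a - (0, 1))) = torus n k2 (c - e)"
    using straight_image[OF _ assms, of "(0, 1)"] unfolding unit_steps_def by auto
  have "f (torus n k1 (a + (0, 1))) \<noteq> f (torus n k1 (a + (1, 0)))"
    "f (torus n k1 (a + (0, 1))) \<noteq> f (torus n k1 (a - (1, 0)))"
    unfolding f_torus_eq_iff by (simp_all add: period_lattice_def)
  then have "perp d e"
    using d e by (auto simp: perp_def)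
  then show ?thesis
    using d e assms unfolding frame_def by blast
qed

text \<open>The lift is affine with the linear part shown here. A period of the source has the same
  image as the origin, so the linear part sends it to a period of the target.\<close>

lemma lattice_image:
  obtains d d' where "perp d d'"
    "\<And>x y. (x, y) \<in> period_lattice n k1 \<Longrightarrow> scale x d + scale y d' \<in> period_lattice n k2"
proof -
  have "f (torus n k1 (0, 0)) \<in> accordion_verts n" using f_in torus_in by blast
  then obtain c where c: "f (torus n k1 (0, 0)) = torus n k2 c"
    using torus_surj[OF n_pos, of k2] by (metis imageE)
  obtain d d' where fr: "frame (\<lambda>a. f (torus n k1 a)) (torus n k2) (1, 0) (0, 1) (0, 0) c d d'"
    using ex_frame[OF c] by blast
  have grid: "f (torus n k1 (x, y)) = torus n k2 (c + scale x d + scale y d')" for x y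
    using k1_ge_3 k ex_frame fr by (intro frame_grid) auto
  have "scale x d + scale y d' \<in> period_lattice n k2" if "(x, y) \<in> period_lattice n k1" for x y
  proof -
    have "f (torus n k1 (x, y)) = f (torus n k1 (0, 0))"
      using that by (simp add: f_torus_eq_iff)
    then show ?thesis
      unfolding grid[of x y] c torus_eq_iff[OF n_pos] by (simp add: add.assoc)
  qed
  moreover have "perp d d'" using fr by (simp add: frame_def)
  ultimately show ?thesis using that by blast
qed

lemma gcd_cong:
  "(gcd n k1 = 2 \<and> gcd n k2 = 2) \<and>
    ([int (k1 * k2 div 2) = 2] (mod int n) \<or> [int (k1 * k2 div 2) = - 2] (mod int n))"
proof -
  obtain d d' where perp: "perp d d'"
    and im: "\<And>x y. (x, y) \<in> period_lattice n k1 \<Longrightarrow> scale x d + scale y d' \<in> period_lattice n k2"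
    using lattice_image by blast
  have k1: "scale (int k1) d + scale 2 d' \<in> period_lattice n k2"
    and n0: "scale (int n) d + scale 0 d' \<in> period_lattice n k2"
    by (rule im, simp add: period_lattice_def)+
  have ne: "\<not> int n dvd int k1 - int k2" "\<not> int n dvd int k1 + int k2"
    using small_multiple_eq_0[of n "int k1 - int k2"] small_multiple_eq_0[of n "int k1 + int k2"] k
    by auto
  have ne': "\<not> int n dvd - int k1 - int k2" "\<not> int n dvd int k2 - int k1"
    using ne by (metis dvd_minus_iff minus_diff_eq minus_add_distrib diff_conv_add_uminus add.commute)+
  \<comment> \<open>A horizontal \<open>d\<close> would keep the axes, and the image of
    \<open>(k1, 2)\<close> would make \<open>n\<close> divide \<open>k1 - k2\<close> or
    \<open>k1 + k2\<close>.\<close>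
  have "snd d \<noteq> 0"
    using perp k1 ne ne' by (auto simp: perp_def unit_steps_def scale_def period_lattice_def)
  then obtain s s' where d: "d = (0, s)" "d' = (s', 0)" and s: "s = 1 \<or> s = -1" "s' = 1 \<or> s' = -1"
    using perp by (auto simp: perp_def unit_steps_def)
  \<comment> \<open>The images of \<open>(k1, 2)\<close> and \<open>(n, 0)\<close> are now
    \<open>(2 * s', s * k1)\<close> and \<open>(0, s * n)\<close>; second coordinates of periods are
    even.\<close>
  have "even (int k1)" "even (int n)"
    using k1 n0 s by (auto simp: d scale_def period_lattice_def)
  then obtain a c where ac: "k1 = 2 * a" "n = 2 * c" by (auto elim!: evenE)
  have "int n dvd int c * int k2"
    using n0 s by (auto simp: d scale_def period_lattice_def ac)
  then have "even k2"
    using n_pos by (auto simp: ac mult.commute[of 2] simp flip: of_nat_mult)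
  then obtain b where b: "k2 = 2 * b" by (auto elim!: evenE)
  have "int n dvd s' * 2 - (s * int a) * int k2"
    using k1 s by (auto simp: d scale_def period_lattice_def ac)
  \<comment> \<open>As \<open>s * s = 1\<close>, this isolates \<open>a * k2\<close>, which is half
    of \<open>k1 * k2\<close>, and leaves the sign \<open>s * s'\<close> on the 2.\<close>
  then have "int n dvd - s * (s' * 2 - (s * int a) * int k2)"
    by (rule dvd_mult)
  then have ab: "int n dvd int (2 * a * b) - 2 \<or> int n dvd int (2 * a * b) - (- 2)"
    using s by (auto simp: b algebra_simps)
  \<comment> \<open>A common divisor of \<open>n\<close> and \<open>k1\<close> or \<open>k2\<close>
    divides \<open>2 * a * b\<close>, hence 2 by the congruence.\<close>
  have "gcd n (2 * x) = 2" if "x = a \<or> x = b" for x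
  proof -
    define g where "g = gcd n (2 * x)"
    have "int g dvd int n" "g dvd 2 * x" by (auto simp: g_def)
    moreover from this have "int g dvd int (2 * a * b)"
      using that dvd_mult2[of g "2 * x" "if x = a then b else a"] unfolding of_nat_dvd_iff
      by (auto simp: ac_simps split: if_splits)
    moreover obtain t :: int where t: "t = 2 \<or> t = -2" "int n dvd int (2 * a * b) - t"
      using ab by blast
    ultimately have "int g dvd int (2 * a * b) - (int (2 * a * b) - t)"
      by (meson dvd_diff dvd_trans)
    then have "int g dvd 2" using t(1) by auto
    then have "g dvd 2" by (metis of_nat_dvd_iff of_nat_numeral)
    moreover have "2 dvd g" by (simp add: g_def ac)
    ultimately show ?thesis by (simp add: dvd_antisym g_def)
  qed
  then show ?thesis
    using ab by (simp add: ac b cong_iff_dvd_diff mult.assoc)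
qed

end

section \<open>Sufficiency: exchanging the axes\<close>

lemma period_lattice_uminus: "- p \<in> period_lattice n k \<Longrightarrow> p \<in> period_lattice n k"
proof -
  assume *: "- p \<in> period_lattice n k"
  obtain x y where p: "p = (x, y)" by fastforce
  obtain m where m: "y = 2 * m" using * by (auto simp: p period_lattice_def elim!: evenE)
  have "- y div 2 = - m" by (simp add: m)
  then have "int n dvd - (x - m * int k)"
    using * by (simp add: p period_lattice_def)
  then have "int n dvd x - m * int k" by (simp only: dvd_minus_iff)
  then show ?thesis by (simp add: p m period_lattice_def)
qed

text \<open>The reflection in the diagonal for \<open>s = 1\<close>, a quarter turn for
  \<open>s = -1\<close>.\<close>

definition axis_swap :: "int \<Rightarrow> int \<times> int \<Rightarrow> int \<times> int" where
  "axis_swap s = (\<lambda>(x, y). (y, s * x))"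

text \<open>On generators: \<open>(n, 0)\<close> goes to \<open>(0, s * n)\<close>, a period since
  \<open>n\<close> and \<open>k2\<close> are even, and \<open>(k1, 2)\<close> to
  \<open>(2, s * k1)\<close>, a period by the congruence.\<close>

lemma axis_swap_lattice:
  assumes "even n" "even k1" "even k2" "s * s = 1" "int n dvd int (k1 * k2 div 2) - 2 * s"
    and "p \<in> period_lattice n k1"
  shows "axis_swap s p \<in> period_lattice n k2"
proof -
  obtain x y where p: "p = (x, y)" by fastforce
  obtain c a b where cab: "n = 2 * c" "k1 = 2 * a" "k2 = 2 * b"
    using assms(1-3) by (auto elim!: evenE)
  obtain m where m: "y = 2 * m" "int n dvd x - m * int k1"
    using assms(6) by (auto simp: p period_lattice_def elim!: evenE)
  obtain j where j: "x - m * int k1 = int n * j" using m(2) by blast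
  obtain i where i: "int (k1 * k2 div 2) - 2 * s = int n * i" using assms(5) by blast
  have x: "x = 2 * (m * int a + int c * j)" using j cab by (simp add: algebra_simps)
  have i': "2 * (int a * int b) = 2 * s + int n * i"
    using i cab by simp
  have "y - (s * x) div 2 * int k2 = 2 * m - s * m * (2 * (int a * int b)) - int n * (s * j * int b)"
    unfolding x m cab by (simp add: algebra_simps)
  also have "\<dots> = int n * (- s * m * i - s * j * int b)"
    unfolding i' using assms(4) by (simp add: algebra_simps)
  finally show ?thesis
    by (simp add: p axis_swap_def period_lattice_def x)
qed

lemma axis_swap_diff: "axis_swap s (p - q) = axis_swap s p - axis_swap s q"
  by (cases p; cases q) (simp add: axis_swap_def right_diff_distrib)

text \<open>The exchange matches the two lattices, so it descends to a bijection of the quotients;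
  it permutes the unit steps, so adjacency is kept.\<close>

lemma accordion_iso_axis_swap:
  assumes n: "3 \<le> n" and k: "1 \<le> k1" "k1 \<le> n" "1 \<le> k2" "k2 \<le> n"
    and even: "even n" "even k1" "even k2" and s: "s * s = 1"
    and cong: "int n dvd int (k1 * k2 div 2) - 2 * s"
  shows "\<exists>f. bij_betw f (accordion_verts n) (accordion_verts n) \<and>
    (\<forall>x\<in>accordion_verts n. \<forall>y\<in>accordion_verts n.
      (x, y) \<in> parcs (accordion n k1) \<longleftrightarrow> (f x, f y) \<in> parcs (accordion n k2))"
proof -
  have n0: "0 < n" using n by simp
  let ?r = "axis_swap s" and ?t1 = "torus n k1" and ?t2 = "torus n k2"
  have s': "s = 1 \<or> s = -1" using s by (metis zmult_eq_1_iff)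
  have L: "p \<in> period_lattice n k1 \<longleftrightarrow> ?r p \<in> period_lattice n k2" for p
  proof
    assume "?r p \<in> period_lattice n k2"
    \<comment> \<open>The conditions are symmetric in \<open>k1\<close> and \<open>k2\<close>, and
      exchanging twice is the identity up to sign.\<close>
    then have "?r (?r p) \<in> period_lattice n k1"
      using cong by (intro axis_swap_lattice[OF even(1,3,2) s]) (auto simp: mult.commute)
    moreover have "?r (?r p) = p \<or> ?r (?r p) = - p"
      using s' by (cases p) (auto simp: axis_swap_def)
    ultimately show "p \<in> period_lattice n k1"
      using period_lattice_uminus by metis
  qed (rule axis_swap_lattice[OF even s cong])
  have eq: "?t1 p = ?t1 q \<longleftrightarrow> ?t2 (?r p) = ?t2 (?r q)" for p q
    unfolding torus_eq_iff[OF n0] L axis_swap_diff ..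
  \<comment> \<open>Any preimage in the grid will do: by \<open>eq\<close> the value does not depend
    on the choice.\<close>
  define f where "f v = ?t2 (?r (SOME p. ?t1 p = v))" for v
  have f: "f (?t1 p) = ?t2 (?r p)" for p
    unfolding f_def eq[symmetric] by (rule someI) simp
  have r_surj: "\<exists>p. ?r p = q" for q
    using s by (cases q) (auto simp: axis_swap_def mult.assoc[symmetric] intro: exI[of _ "s * _"])
  have r_units: "?r ` unit_steps = unit_steps"
    using s' by (auto simp: axis_swap_def unit_steps_def)
  have r_add: "?r (p + d) = ?r p + ?r d" for p d
    by (cases p; cases d) (simp add: axis_swap_def distrib_left)
  have "inj_on f (range ?t1)"
    by (auto simp: inj_on_def f eq)
  moreover have "f ` range ?t1 = range ?t2"
    using r_surj by (auto simp: f image_iff) metis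
  ultimately have "bij_betw f (accordion_verts n) (accordion_verts n)"
    unfolding bij_betw_def torus_surj[OF n0] by simp
  moreover have "(?t1 p, ?t1 q) \<in> parcs (accordion n k1) \<longleftrightarrow> (f (?t1 p), f (?t1 q)) \<in> parcs (accordion n k2)"
    for p q
  proof -
    have "(f (?t1 p), f (?t1 q)) \<in> parcs (accordion n k2) \<longleftrightarrow>
      (\<exists>d\<in>?r ` unit_steps. ?t2 (?r q) = ?t2 (?r p + d))"
      unfolding f torus_arc_iff[OF n k(3,4)] r_units by blast
    also have "\<dots> \<longleftrightarrow> (\<exists>d\<in>unit_steps. ?t1 q = ?t1 (p + d))"
      by (simp add: eq r_add)
    finally show ?thesis
      unfolding torus_arc_iff[OF n k(1,2)] by blast
  qed
  ultimately show ?thesis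
    unfolding torus_surj[OF n0, of k1, symmetric] by (intro exI[of _ f]) auto
qed

theorem theorem2p3:
  fixes n k1 k2 :: nat
  assumes "n \<ge> 3" and "1 \<le> k1" and "k1 < k2" and "real k2 \<le> real n / 2"
  shows "digraph_iso (with_proj (accordion n k1)) (with_proj (accordion n k2)) \<longleftrightarrow>
    (gcd n k1 = 2 \<and> gcd n k2 = 2) \<and>
    ([int (k1 * k2 div 2) = 2] (mod int n) \<or> [int (k1 * k2 div 2) = - 2] (mod int n))"
    (is "?iso \<longleftrightarrow> ?rhs")
proof -
  have k: "2 * k2 \<le> n" "k1 \<le> n" "1 \<le> k2" "k2 \<le> n" using assms by linarith+
  interpret G1: pair_graph "accordion n k1" using pair_graph_accordion[OF assms(1)] .
  interpret G2: pair_graph "accordion n k2" using pair_graph_accordion[OF assms(1)] .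
  have iso: "?iso \<longleftrightarrow> (\<exists>f. bij_betw f (accordion_verts n) (accordion_verts n) \<and>
    (\<forall>x\<in>accordion_verts n. \<forall>y\<in>accordion_verts n.
      (x, y) \<in> parcs (accordion n k1) \<longleftrightarrow> (f x, f y) \<in> parcs (accordion n k2)))"
    using digraph_iso_pair_iff[OF G1.pair_wf_digraph_axioms G2.pair_wf_digraph_axioms]
    by (simp add: accordion_def)
  show ?thesis
  proof
    assume ?iso
    then obtain f where "accordion_iso n k1 k2 f"
      unfolding iso accordion_iso_def using assms k by blast
    then show ?rhs by (rule accordion_iso.gcd_cong)
  next
    assume rhs: ?rhs
    then have even: "even n" "even k1" "even k2" by (metis gcd_dvd1 gcd_dvd2)+
    have "int n dvd int (k1 * k2 div 2) - 2 * 1 \<or> int n dvd int (k1 * k2 div 2) - 2 * (- 1)"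
      using rhs by (auto simp: cong_iff_dvd_diff)
    \<comment> \<open>The sign in the congruence selects the reflection or the quarter turn.\<close>
    then obtain s where "s * s = 1" "int n dvd int (k1 * k2 div 2) - 2 * s"
      by (metis mult_1 minus_mult_minus)
    then show ?iso
      unfolding iso using accordion_iso_axis_swap assms k even by blast
  qed
qed

end
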